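(* Let $\alpha,\beta,\lambda\in[0,1]$, and consider the Constrained Hybrid Borda (CHB) rule with these parameters, applied to profiles of $k$ strict complete rankings of the $m$ candidates $p_1,\dots,p_m$. Then CHB is deterministic (the same profile always produces the same outcome), computable (its outcome is produced in finitely many computational steps), and yields a unique outcome: for every profile $\Pi$ of $k$ rankings there is exactly one candidate $p\in\{p_1,\dots,p_m\}$ with $F_{\mathrm{CHB}}(\Pi)=p$.
   Context: Let $\mathcal P=\{p_1,\dots,p_m\}$. A profile $\Pi=(R_1,\dots,R_k)$ is a list of $k$ ballots, each a strict complete ranking of $\mathcal P$. The Borda score $B(p_j)$ is the sum over ballots of the points of $p_j$, where a candidate in position $i$ of a ballot ($i=1$ is the top) gets $m-i$ points. The first-place count $t_j$ is the number of ballots that rank $p_j$ first. Let $B_{\max}=\max_j B(p_j)$. A candidate is $\alpha$-popular if $t_j\ge\lceil\alpha k\rceil$. The hybrid score is $$H(p_j)=(1-\lambda)\frac{B(p_j)}{k(m-1)}+\lambda\frac{t_j}{k}.$$ CHB selects a winner as follows. (1) Let $p_{B}$ be the candidate of maximum Borda score. If $p_B$ is $\alpha$-popular, $p_B$ wins. (2) Otherwise, form the set of eligible candidates, namely all $p_j$ that are $\alpha$-popular and satisfy $B(p_j)\ge\beta B_{\max}$. If this set is non-empty, the eligible candidate with the highest hybrid score wins. (3) If the eligible set is empty, $p_B$ wins. At every stage ties are broken by the deterministic lexicographic rule: the tied candidate with the lowest index is chosen. *)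

theory Defs
  imports Complex_Main
begin

section \<open>Ballots, profiles and scores\<close>

text \<open>Candidates are their indices \<open>1, \<dots>, m\<close>.  A ballot lists all of them, best first.\<close>

definition candidates :: "nat \<Rightarrow> nat set" where
  "candidates m = {1..m}"

definition ballot :: "nat \<Rightarrow> nat list \<Rightarrow> bool" where
  "ballot m R \<longleftrightarrow> distinct R \<and> set R = candidates m"

definition profile :: "nat \<Rightarrow> nat \<Rightarrow> nat list list \<Rightarrow> bool" where
  "profile m k \<Pi> \<longleftrightarrow> length \<Pi> = k \<and> (\<forall>R\<in>set \<Pi>. ballot m R)"

text \<open>Positions are counted from 1 (top).\<close>

definition position :: "nat list \<Rightarrow> nat \<Rightarrow> nat" where
  "position R p = Suc (length (takeWhile (\<lambda>q. q \<noteq> p) R))"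

definition borda :: "nat \<Rightarrow> nat list list \<Rightarrow> nat \<Rightarrow> nat" where
  "borda m \<Pi> p = (\<Sum>R\<leftarrow>\<Pi>. m - position R p)"

definition first_count :: "nat list list \<Rightarrow> nat \<Rightarrow> nat" where
  "first_count \<Pi> p = length (filter (\<lambda>R. position R p = 1) \<Pi>)"

definition borda_max :: "nat \<Rightarrow> nat list list \<Rightarrow> nat" where
  "borda_max m \<Pi> = Max (borda m \<Pi> ` candidates m)"

definition popular :: "real \<Rightarrow> nat list list \<Rightarrow> nat \<Rightarrow> bool" where
  "popular \<alpha> \<Pi> p \<longleftrightarrow> int (first_count \<Pi> p) \<ge> \<lceil>\<alpha> * real (length \<Pi>)\<rceil>"

text \<open>
  For \<open>m = 1\<close> or an empty profile the denominators below vanish.  This is harmless: the rule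
  below then always selects the Borda winner without consulting the hybrid scores.
\<close>

definition hybrid :: "real \<Rightarrow> nat \<Rightarrow> nat list list \<Rightarrow> nat \<Rightarrow> real" where
  "hybrid lam m \<Pi> p =
     (1 - lam) * (real (borda m \<Pi> p) / (real (length \<Pi>) * (real m - 1)))
     + lam * (real (first_count \<Pi> p) / real (length \<Pi>))"

definition eligible :: "real \<Rightarrow> real \<Rightarrow> nat \<Rightarrow> nat list list \<Rightarrow> nat set" where
  "eligible \<alpha> \<beta> m \<Pi> =
     {p \<in> candidates m. popular \<alpha> \<Pi> p \<and> real (borda m \<Pi> p) \<ge> \<beta> * real (borda_max m \<Pi>)}"


section \<open>The Constrained Hybrid Borda rule\<close>

text \<open>\<open>p\<close> has maximal score in \<open>S\<close>, and has the lowest index among the maximisers.\<close>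

definition selects :: "(nat \<Rightarrow> 'a::linorder) \<Rightarrow> nat set \<Rightarrow> nat \<Rightarrow> bool" where
  "selects score S p \<longleftrightarrow> p \<in> S \<and> (\<forall>q\<in>S. score q \<le> score p)
     \<and> (\<forall>q\<in>S. score q = score p \<longrightarrow> p \<le> q)"

text \<open>
  \<open>CHB \<alpha> \<beta> lam m \<Pi> p\<close> says that the rule may declare \<open>p\<close> the winner.  It is introduced as a
  relation, so that existence and uniqueness of the outcome are not built into the type.
\<close>

inductive CHB :: "real \<Rightarrow> real \<Rightarrow> real \<Rightarrow> nat \<Rightarrow> nat list list \<Rightarrow> nat \<Rightarrow> bool"
  for \<alpha> \<beta> lam :: real and m :: nat and \<Pi> :: "nat list list" where
  popular_borda_winner:
    "selects (borda m \<Pi>) (candidates m) b \<Longrightarrow> popular \<alpha> \<Pi> b \<Longrightarrow> CHB \<alpha> \<beta> lam m \<Pi> b"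
| hybrid_winner:
    "selects (borda m \<Pi>) (candidates m) b \<Longrightarrow> \<not> popular \<alpha> \<Pi> b \<Longrightarrow> eligible \<alpha> \<beta> m \<Pi> \<noteq> {}
     \<Longrightarrow> selects (hybrid lam m \<Pi>) (eligible \<alpha> \<beta> m \<Pi>) p \<Longrightarrow> CHB \<alpha> \<beta> lam m \<Pi> p"
| fallback:
    "selects (borda m \<Pi>) (candidates m) b \<Longrightarrow> \<not> popular \<alpha> \<Pi> b \<Longrightarrow> eligible \<alpha> \<beta> m \<Pi> = {}
     \<Longrightarrow> CHB \<alpha> \<beta> lam m \<Pi> b"


section \<open>Computability over the reals\<close>

text \<open>
  The parameters are arbitrary real numbers, so computability is meant in the real-arithmetic
  (Blum--Shub--Smale, real RAM) sense: the elementary operations are natural-number arithmetic,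
  the four field operations on reals, comparisons, and access to the input.  Programs are finite
  syntactic objects with natural-number constants only; all real data comes from the input.
  One step executes one assignment or one test, or passes to the next command of a sequence.
\<close>

type_synonym input = "nat list \<times> real list"
type_synonym store = "(nat \<Rightarrow> nat) \<times> (nat \<Rightarrow> real)"

text \<open>\<open>NIn e\<close> and \<open>RIn e\<close> read the input entry with the computed index \<open>e\<close>.\<close>

datatype nexp =
    NConst nat | NVar nat | NIn nexp | NAdd nexp nexp | NSub nexp nexp | NMul nexp nexp

datatype rexp =
    RNat nexp | RVar nat | RIn nexp
  | RAdd rexp rexp | RSub rexp rexp | RMul rexp rexp | RDiv rexp rexp

datatype bexp = NLess nexp nexp | RLess rexp rexp | BNot bexp | BAnd bexp bexp

datatype com =
    SKIP | NAssign nat nexp | RAssign nat rexp | Seq com com | Cond bexp com com | While bexp com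

primrec nval :: "input \<Rightarrow> nexp \<Rightarrow> store \<Rightarrow> nat" where
  "nval i (NConst n) s = n"
| "nval i (NVar x) s = fst s x"
| "nval i (NIn e) s = (if nval i e s < length (fst i) then fst i ! nval i e s else 0)"
| "nval i (NAdd e f) s = nval i e s + nval i f s"
| "nval i (NSub e f) s = nval i e s - nval i f s"
| "nval i (NMul e f) s = nval i e s * nval i f s"

primrec rval :: "input \<Rightarrow> rexp \<Rightarrow> store \<Rightarrow> real" where
  "rval i (RNat e) s = real (nval i e s)"
| "rval i (RVar x) s = snd s x"
| "rval i (RIn e) s = (if nval i e s < length (snd i) then snd i ! nval i e s else 0)"
| "rval i (RAdd e f) s = rval i e s + rval i f s"
| "rval i (RSub e f) s = rval i e s - rval i f s"
| "rval i (RMul e f) s = rval i e s * rval i f s"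
| "rval i (RDiv e f) s = rval i e s / rval i f s"

primrec bval :: "input \<Rightarrow> bexp \<Rightarrow> store \<Rightarrow> bool" where
  "bval i (NLess e f) s \<longleftrightarrow> nval i e s < nval i f s"
| "bval i (RLess e f) s \<longleftrightarrow> rval i e s < rval i f s"
| "bval i (BNot b) s \<longleftrightarrow> \<not> bval i b s"
| "bval i (BAnd b c) s \<longleftrightarrow> bval i b s \<and> bval i c s"

fun step :: "input \<Rightarrow> com \<times> store \<Rightarrow> com \<times> store" where
  "step i (SKIP, s) = (SKIP, s)"
| "step i (NAssign x e, s) = (SKIP, ((fst s)(x := nval i e s), snd s))"
| "step i (RAssign x e, s) = (SKIP, (fst s, (snd s)(x := rval i e s)))"
| "step i (Seq c d, s) =
     (if c = SKIP then (d, s) else let (c', s') = step i (c, s) in (Seq c' d, s'))"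
| "step i (Cond b c d, s) = (if bval i b s then c else d, s)"
| "step i (While b c, s) = (if bval i b s then Seq c (While b c) else SKIP, s)"

text \<open>
  Started with all variables 0, the program reaches the halting command \<open>SKIP\<close> after finitely
  many steps, leaving the result in the natural-number variable 0.
\<close>

definition halts_with :: "com \<Rightarrow> input \<Rightarrow> nat \<Rightarrow> bool" where
  "halts_with P i r \<longleftrightarrow>
     (\<exists>n s. (step i ^^ n) (P, (\<lambda>_. 0, \<lambda>_. 0)) = (SKIP, s) \<and> fst s 0 = r)"

definition chb_input :: "real \<Rightarrow> real \<Rightarrow> real \<Rightarrow> nat \<Rightarrow> nat \<Rightarrow> nat list list \<Rightarrow> input" where
  "chb_input \<alpha> \<beta> lam m k \<Pi> = (m # k # concat \<Pi>, [\<alpha>, \<beta>, lam])"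

text \<open>
  One program has to serve all numbers of candidates and voters; for fixed \<open>m\<close> and \<open>k\<close> there are
  only finitely many profiles, and a lookup table would do.
\<close>

definition CHB_computable :: "real \<Rightarrow> real \<Rightarrow> real \<Rightarrow> bool" where
  "CHB_computable \<alpha> \<beta> lam \<longleftrightarrow>
     (\<exists>P. \<forall>m k \<Pi>. m \<ge> 1 \<longrightarrow> profile m k \<Pi> \<longrightarrow>
        (\<exists>p. CHB \<alpha> \<beta> lam m \<Pi> p \<and> halts_with P (chb_input \<alpha> \<beta> lam m k \<Pi>) p))"

definition CHB_deterministic :: "real \<Rightarrow> real \<Rightarrow> real \<Rightarrow> bool" where
  "CHB_deterministic \<alpha> \<beta> lam \<longleftrightarrow>
     (\<forall>m k \<Pi> p q. m \<ge> 1 \<longrightarrow> profile m k \<Pi> \<longrightarrow>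
        CHB \<alpha> \<beta> lam m \<Pi> p \<longrightarrow> CHB \<alpha> \<beta> lam m \<Pi> q \<longrightarrow> p = q)"

end

theory Submission
  imports Defs
begin

text \<open>
  Every stage of the rule picks the least maximiser of a score, and such a candidate is unique;
  hence so is the outcome.  A linear scan of the candidates, which replaces the current best only
  by a strictly better one, finds the least maximiser.  The store has no arrays, so the program
  recomputes the Borda score and the first-place count of each candidate from the input whenever
  they are needed.  The comparison with \<open>\<lceil>\<alpha> k\<rceil>\<close> needs no rounding, because the count is an
  integer.  Since the program always reaches an outcome of the rule, it also shows that one exists.
\<close>

section \<open>Selecting the least maximiser\<close>

lemma selects_unique: "selects f S p \<Longrightarrow> selects f S q \<Longrightarrow> p = q"
  unfolding selects_def by (meson order_antisym)

lemma selects_in: "selects f S p \<Longrightarrow> p \<in> S"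
  by (simp add: selects_def)

text \<open>The program keeps the current best score in a real variable, while Borda scores are
  naturals; the embedding preserves order and equality.\<close>

lemma selects_real_iff: "selects (\<lambda>p. real (f p)) S p \<longleftrightarrow> selects f S p"
  by (simp add: selects_def)

lemma selects_singleton: "selects f {p} p"
  by (simp add: selects_def)

text \<open>As \<open>p\<close> has the largest index, a tie must leave \<open>w\<close> in place;
  hence the strict comparison. This is one round of the linear scan.\<close>

lemma selects_insert_above:
  assumes "selects f S w" and "\<And>q. q \<in> S \<Longrightarrow> q < p"
  shows "selects f (insert p S) (if f w < f p then p else w)"
  using assms unfolding selects_def
  by (auto simp: not_less intro: less_imp_le order.trans)

text \<open>Lets the program obtain the maximum by computing the score of the Borda winner.\<close>

lemma borda_max_eq:
  assumes "selects (borda m \<Pi>) (candidates m) b"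
  shows "borda_max m \<Pi> = borda m \<Pi> b"
  unfolding borda_max_def
  using assms by (intro Max_eqI) (auto simp: selects_def candidates_def)

text \<open>The Borda winner is unique, so its popularity and the emptiness of the eligible set
  decide which single rule applies.\<close>

lemma CHB_unique:
  assumes "CHB \<alpha> \<beta> lam m \<Pi> p" and "CHB \<alpha> \<beta> lam m \<Pi> q"
  shows "p = q"
  using assms by (auto elim!: CHB.cases dest: selects_unique)

lemma CHB_in_candidates: "CHB \<alpha> \<beta> lam m \<Pi> p \<Longrightarrow> p \<in> candidates m"
  by (auto elim!: CHB.cases dest!: selects_in simp: eligible_def)

lemma popular_iff: "popular \<alpha> \<Pi> p \<longleftrightarrow> \<alpha> * real (length \<Pi>) \<le> real (first_count \<Pi> p)"
  by (simp add: popular_def ceiling_le_iff)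


section \<open>Positions in a ballot\<close>

lemma position_nth:
  assumes "distinct R" and "j < length R"
  shows "position R (R ! j) = Suc j"
proof -
  have "takeWhile (\<lambda>q. q \<noteq> R ! j) R = take j R"
    using assms by (intro takeWhile_eq_take_P_nth) (auto simp: nth_eq_iff_index_eq)
  with assms show ?thesis
    by (simp add: position_def)
qed

text \<open>The default is one past the end: for a ballot of length \<open>m\<close> the truncated
  difference \<open>m - position R p\<close> is then 0, matching a scan that never meets
  \<open>p\<close>.\<close>

lemma position_notin: "p \<notin> set R \<Longrightarrow> position R p = Suc (length R)"
  by (induction R) (auto simp: position_def)

lemma position_eq_1_iff: "R \<noteq> [] \<Longrightarrow> position R p = 1 \<longleftrightarrow> R ! 0 = p"
  by (cases R) (auto simp: position_def)

lemma ballot_length: "ballot m R \<Longrightarrow> length R = m"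
  by (metis ballot_def candidates_def card_atLeastAtMost diff_Suc_1 distinct_card)

text \<open>Row-major indexing of the flattened profile: each row peeled off in the induction shifts
  the index by exactly \<open>m\<close>.\<close>

lemma concat_nth_rectangular:
  assumes "\<forall>R\<in>set xss. length R = m" and "r < length xss" and "j < m"
  shows "r * m + j < length (concat xss) \<and> concat xss ! (r * m + j) = xss ! r ! j"
  using assms(1,2)
proof (induction xss arbitrary: r)
  case (Cons R xss)
  show ?case
  proof (cases r)
    case 0
    with Cons.prems assms(3) show ?thesis by (simp add: nth_append)
  next
    case (Suc r')
    with Cons.prems Cons.IH[of r'] show ?thesis
      by (simp add: nth_append)
  qed
qed simp

lemma borda_take_Suc:
  "r < length \<Pi> \<Longrightarrow> borda m (take (Suc r) \<Pi>) p = borda m (take r \<Pi>) p + (m - position (\<Pi> ! r) p)"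
  by (simp add: borda_def take_Suc_conv_app_nth)

lemma first_count_take_Suc:
  "r < length \<Pi> \<Longrightarrow> first_count (take (Suc r) \<Pi>) p
     = first_count (take r \<Pi>) p + (if position (\<Pi> ! r) p = 1 then 1 else 0)"
  by (simp add: first_count_def take_Suc_conv_app_nth)


section \<open>Weakest preconditions\<close>

text \<open>Total correctness: termination is part of the predicate, so that \<open>wp\<close> from
  the zero store yields \<open>halts_with\<close>.\<close>

definition wp :: "input \<Rightarrow> com \<Rightarrow> (store \<Rightarrow> bool) \<Rightarrow> store \<Rightarrow> bool" where
  "wp i c Q s \<longleftrightarrow> (\<exists>n t. (step i ^^ n) (c, s) = (SKIP, t) \<and> Q t)"

lemma wp_step: "wp i c' Q s' \<Longrightarrow> step i (c, s) = (c', s') \<Longrightarrow> wp i c Q s"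
  unfolding wp_def by (metis comp_apply funpow_Suc_right)

lemma wp_SKIP: "Q s \<Longrightarrow> wp i SKIP Q s"
  unfolding wp_def by (metis funpow_0)

lemma wp_NAssign: "Q ((fst s)(x := nval i e s), snd s) \<Longrightarrow> wp i (NAssign x e) Q s"
  by (rule wp_step[OF wp_SKIP]) simp_all

lemma wp_RAssign: "Q (fst s, (snd s)(x := rval i e s)) \<Longrightarrow> wp i (RAssign x e) Q s"
  by (rule wp_step[OF wp_SKIP]) simp_all

lemma wp_Cond:
  "(bval i b s \<Longrightarrow> wp i c Q s) \<Longrightarrow> (\<not> bval i b s \<Longrightarrow> wp i d Q s) \<Longrightarrow> wp i (Cond b c d) Q s"
  by (rule wp_step[of i "if bval i b s then c else d"]) simp_all

lemma step_SKIP_funpow: "(step i ^^ n) (SKIP, s) = (SKIP, s)"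
  by (induction n) simp_all

text \<open>The step count \<open>k\<close> stays existential because \<open>c\<close> may reach
  \<open>SKIP\<close> early and idle there; one extra step passes control to
  \<open>d\<close>.\<close>

lemma Seq_reaches:
  "(step i ^^ n) (c, s) = (SKIP, t) \<Longrightarrow> \<exists>k. (step i ^^ k) (Seq c d, s) = (d, t)"
proof (induction n arbitrary: c s)
  case 0
  then have "(step i ^^ 1) (Seq c d, s) = (d, t)" by simp
  then show ?case ..
next
  case (Suc n)
  show ?case
  proof (cases "c = SKIP")
    case True
    with Suc.prems have "(step i ^^ 1) (Seq c d, s) = (d, t)"
      by (simp add: step_SKIP_funpow)
    then show ?thesis ..
  next
    case False
    obtain c' s' where c': "step i (c, s) = (c', s')" by (cases "step i (c, s)")
    with Suc.prems have "(step i ^^ n) (c', s') = (SKIP, t)"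
      by (simp add: funpow_Suc_right del: funpow.simps(2))
    from Suc.IH[OF this] obtain k where "(step i ^^ k) (Seq c' d, s') = (d, t)" ..
    with False c' have "(step i ^^ Suc k) (Seq c d, s) = (d, t)"
      by (simp add: funpow_Suc_right del: funpow.simps(2))
    then show ?thesis ..
  qed
qed

lemma wp_Seq:
  assumes "wp i c (wp i d Q) s"
  shows "wp i (Seq c d) Q s"
proof -
  from assms obtain n t n' t' where "(step i ^^ n) (c, s) = (SKIP, t)"
    and d: "(step i ^^ n') (d, t) = (SKIP, t')" "Q t'"
    unfolding wp_def by blast
  then obtain k where "(step i ^^ k) (Seq c d, s) = (d, t)"
    using Seq_reaches by blast
  with d have "(step i ^^ (n' + k)) (Seq c d, s) = (SKIP, t')"
    by (simp add: funpow_add)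
  with d show ?thesis
    unfolding wp_def by blast
qed

lemma wp_mono: "wp i c Q s \<Longrightarrow> (\<And>t. Q t \<Longrightarrow> Q' t) \<Longrightarrow> wp i c Q' s"
  unfolding wp_def by blast

text \<open>Strong induction on the variant \<open>\<mu>\<close>: its decrease in the body bounds
  the number of iterations and so gives termination.\<close>

lemma wp_While:
  fixes \<mu> :: "store \<Rightarrow> nat"
  assumes "I s"
    and body: "\<And>s. I s \<Longrightarrow> bval i b s \<Longrightarrow> wp i c (\<lambda>t. I t \<and> \<mu> t < \<mu> s) s"
    and exit: "\<And>s. I s \<Longrightarrow> \<not> bval i b s \<Longrightarrow> Q s"
  shows "wp i (While b c) Q s"
  using assms(1)
proof (induction "\<mu> s" arbitrary: s rule: less_induct)
  case less
  show ?case
  proof (cases "bval i b s")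
    case True
    have "wp i (Seq c (While b c)) Q s"
      by (intro wp_Seq wp_mono[OF body[OF less.prems True]]) (use less.hyps in blast)
    with True show ?thesis
      by (auto intro: wp_step)
  next
    case False
    with exit less.prems show ?thesis
      by (intro wp_step[OF wp_SKIP[of Q s]]) simp_all
  qed
qed


section \<open>The program\<close>

text \<open>Natural-number variables; the only real variable, 0, holds the score of the current best.\<close>

abbreviation (input) "v_win \<equiv> 0 :: nat"
abbreviation (input) "v_cand \<equiv> 1 :: nat"
abbreviation (input) "v_borda \<equiv> 2 :: nat"
abbreviation (input) "v_first \<equiv> 3 :: nat"
abbreviation (input) "v_row \<equiv> 4 :: nat"
abbreviation (input) "v_col \<equiv> 5 :: nat"
abbreviation (input) "v_bwin \<equiv> 6 :: nat"
abbreviation (input) "v_bmax \<equiv> 7 :: nat"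

abbreviation (input) "e_m \<equiv> NIn (NConst 0)"
abbreviation (input) "e_k \<equiv> NIn (NConst 1)"

definition incr :: "nat \<Rightarrow> com" where
  "incr x = NAssign x (NAdd (NVar x) (NConst 1))"

definition NEq :: "nexp \<Rightarrow> nexp \<Rightarrow> bexp" where
  "NEq e f = BAnd (BNot (NLess e f)) (BNot (NLess f e))"

definition BOr :: "bexp \<Rightarrow> bexp \<Rightarrow> bexp" where
  "BOr b c = BNot (BAnd (BNot b) (BNot c))"

lemma bval_NEq [simp]: "bval i (NEq e f) s \<longleftrightarrow> nval i e s = nval i f s"
  by (auto simp: NEq_def)

lemma bval_BOr [simp]: "bval i (BOr b c) s \<longleftrightarrow> bval i b s \<or> bval i c s"
  by (simp add: BOr_def)

text \<open>The offset 2 skips \<open>m\<close> and \<open>k\<close> at the head of the input; the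
  ballots follow row by row.\<close>

definition entry :: "nexp \<Rightarrow> nexp" where
  "entry j = NIn (NAdd (NConst 2) (NAdd (NMul (NVar v_row) e_m) j))"

definition scan_ballot :: com where
  "scan_ballot = Seq (NAssign v_col (NConst 0))
     (While (NLess (NVar v_col) e_m)
       (Seq
         (Cond (NEq (entry (NVar v_col)) (NVar v_cand))
           (NAssign v_borda
             (NAdd (NVar v_borda) (NSub e_m (NAdd (NVar v_col) (NConst 1)))))
           SKIP)
         (incr v_col)))"

definition compute_scores :: com where
  "compute_scores =
     Seq (NAssign v_borda (NConst 0)) (Seq (NAssign v_first (NConst 0))
       (Seq (NAssign v_row (NConst 0))
         (While (NLess (NVar v_row) e_k)
           (Seq (Cond (NEq (entry (NConst 0)) (NVar v_cand)) (incr v_first) SKIP)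
             (Seq scan_ballot (incr v_row))))))"

text \<open>Index 0 is no candidate, so \<open>v_win = 0\<close> means that none has passed the
  guard \<open>g\<close> yet. Both \<open>g\<close> and \<open>e\<close> may read the scores of
  \<open>v_cand\<close>, recomputed in each round.\<close>

definition argmax :: "bexp \<Rightarrow> rexp \<Rightarrow> com" where
  "argmax g e =
     Seq (NAssign v_win (NConst 0)) (Seq (NAssign v_cand (NConst 1))
       (While (BNot (NLess e_m (NVar v_cand)))
         (Seq compute_scores
           (Seq
             (Cond (BAnd g (BOr (NEq (NVar v_win) (NConst 0)) (RLess (RVar 0) e)))
               (Seq (NAssign v_win (NVar v_cand)) (RAssign 0 e))
               SKIP)
             (incr v_cand)))))"

definition e_popular :: bexp where
  "e_popular = BNot (RLess (RNat (NVar v_first)) (RMul (RIn (NConst 0)) (RNat e_k)))"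

definition e_eligible :: bexp where
  "e_eligible = BAnd e_popular
     (BNot (RLess (RNat (NVar v_borda)) (RMul (RIn (NConst 1)) (RNat (NVar v_bmax)))))"

definition e_hybrid :: rexp where
  "e_hybrid = RAdd
     (RMul (RSub (RNat (NConst 1)) (RIn (NConst 2)))
       (RDiv (RNat (NVar v_borda)) (RMul (RNat e_k) (RSub (RNat e_m) (RNat (NConst 1))))))
     (RMul (RIn (NConst 2)) (RDiv (RNat (NVar v_first)) (RNat e_k)))"

text \<open>The first scan leaves the score variables at the last candidate, so they are recomputed
  for the Borda winner. Its index and score are saved because the second scan overwrites
  \<open>v_win\<close> and \<open>v_borda\<close>.\<close>

definition chb_program :: com where
  "chb_program =
     Seq (argmax (NEq (NConst 0) (NConst 0)) (RNat (NVar v_borda)))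
       (Seq (NAssign v_cand (NVar v_win))
         (Seq compute_scores
           (Seq (NAssign v_bwin (NVar v_win))
             (Seq (NAssign v_bmax (NVar v_borda))
               (Cond e_popular SKIP
                 (Seq (argmax e_eligible e_hybrid)
                   (Cond (NEq (NVar v_win) (NConst 0)) (NAssign v_win (NVar v_bwin)) SKIP)))))))"


section \<open>Correctness of the program\<close>

locale chb_instance =
  fixes \<alpha> \<beta> lam :: real and m k :: nat and \<Pi> :: "nat list list" and i :: input
  assumes m_pos: "m \<ge> 1" and prof: "profile m k \<Pi>"
    and i_def: "i = chb_input \<alpha> \<beta> lam m k \<Pi>"
begin

lemma k_eq: "length \<Pi> = k"
  using prof by (simp add: profile_def)

lemma inputs [simp]:
  "fst i ! 0 = m" "fst i ! Suc 0 = k" "length (fst i) = Suc (Suc (length (concat \<Pi>)))"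
  "snd i ! 0 = \<alpha>" "snd i ! Suc 0 = \<beta>" "snd i ! 2 = lam" "length (snd i) = 3"
  by (simp_all add: i_def chb_input_def)

lemma row_ballot: "r < k \<Longrightarrow> ballot m (\<Pi> ! r)"
  using prof by (auto simp: profile_def)

lemma row_length: "r < k \<Longrightarrow> length (\<Pi> ! r) = m"
  using row_ballot ballot_length by blast

lemma nval_entry:
  assumes "fst s v_row < k" and "nval i j s < m"
  shows "nval i (entry j) s = \<Pi> ! fst s v_row ! nval i j s"
proof -
  have "\<forall>R\<in>set \<Pi>. length R = m"
    using prof ballot_length by (auto simp: profile_def)
  from concat_nth_rectangular[OF this _ assms(2)] assms(1) k_eq
  show ?thesis
    by (simp add: entry_def i_def chb_input_def)
qed

text \<open>An arbitrary postcondition \<open>Q\<close> lets the lemma be applied like the rules for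
  single commands.\<close>

lemma wp_scan_ballot:
  assumes r: "fst s v_row < k"
    and Q: "\<And>t. fst t v_borda = fst s v_borda + (m - position (\<Pi> ! fst s v_row) (fst s v_cand)) \<Longrightarrow>
      \<forall>x. x \<notin> {v_borda, v_col} \<longrightarrow> fst t x = fst s x \<Longrightarrow> snd t = snd s \<Longrightarrow> Q t"
  shows "wp i scan_ballot Q s"
proof -
  define R p where "R = \<Pi> ! fst s v_row" and "p = fst s v_cand"
  have R: "distinct R" "length R = m"
    using r row_ballot row_length by (auto simp: R_def ballot_def)
  define I where "I t \<longleftrightarrow> fst t v_col \<le> m
    \<and> fst t v_borda = fst s v_borda + (if p \<in> set (take (fst t v_col) R) then m - position R p else 0)
    \<and> (\<forall>x. x \<notin> {v_borda, v_col} \<longrightarrow> fst t x = fst s x) \<and> snd t = snd s" for t :: store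
  show ?thesis
    unfolding scan_ballot_def
  proof (rule wp_Seq, rule wp_NAssign,
      rule wp_While[where I = I and \<mu> = "\<lambda>t. m - fst t v_col"], goal_cases)
    case 1
    show ?case by (simp add: I_def)
  next
    case (2 t)
    define j where "j = fst t v_col"
    have j: "j < m" using 2 by (simp add: j_def)
    have e: "nval i (entry (NVar v_col)) t = R ! j"
      using 2 r j by (subst nval_entry) (auto simp: I_def R_def j_def)
    have cand: "fst t v_cand = p"
      using 2 by (simp add: I_def p_def)
    have tk: "take (Suc j) R = take j R @ [R ! j]"
      using j R by (simp add: take_Suc_conv_app_nth)
    \<comment> \<open>By distinctness a match in column \<open>j\<close> is the only one, so the
      points are added at most once and equal \<open>m - Suc j\<close>.\<close>
    have pos: "position R (R ! j) = Suc j" and new: "R ! j \<notin> set (take j R)"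
      using j R by (auto simp: position_nth in_set_conv_nth nth_eq_iff_index_eq)
    show ?case
      unfolding incr_def
      using 2 j pos new tk cand e
      by (intro wp_Seq wp_Cond wp_NAssign wp_SKIP)
         (auto simp: I_def j_def[symmetric])
  next
    case (3 t)
    then have "fst t v_col = m" by (simp add: I_def)
    with 3 R show ?case
      by (intro Q) (auto simp: I_def R_def[symmetric] p_def position_notin)
  qed
qed

lemma wp_compute_scores:
  assumes Q: "\<And>t. fst t v_borda = borda m \<Pi> (fst s v_cand) \<Longrightarrow>
      fst t v_first = first_count \<Pi> (fst s v_cand) \<Longrightarrow>
      \<forall>x. x \<notin> {v_borda, v_first, v_row, v_col} \<longrightarrow> fst t x = fst s x \<Longrightarrow> snd t = snd s \<Longrightarrow> Q t"
  shows "wp i compute_scores Q s"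
proof -
  define p where "p = fst s v_cand"
  \<comment> \<open>The ballots read so far form a prefix, so the invariant speaks of the scores in
    the truncated profile.\<close>
  define I where "I t \<longleftrightarrow> fst t v_row \<le> k
    \<and> fst t v_borda = borda m (take (fst t v_row) \<Pi>) p
    \<and> fst t v_first = first_count (take (fst t v_row) \<Pi>) p
    \<and> (\<forall>x. x \<notin> {v_borda, v_first, v_row, v_col} \<longrightarrow> fst t x = fst s x) \<and> snd t = snd s"
    for t :: store
  show ?thesis
    unfolding compute_scores_def
  proof (intro wp_Seq wp_NAssign,
      rule wp_While[where I = I and \<mu> = "\<lambda>t. k - fst t v_row"], goal_cases)
    case 1
    show ?case by (simp add: I_def borda_def first_count_def)
  next
    case (2 t)
    define r where "r = fst t v_row"
    have r: "r < k" using 2 by (simp add: r_def)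
    \<comment> \<open>With \<open>m \<ge> 1\<close> column 0 lies inside row \<open>r\<close>, so
      this reads the top of that ballot.\<close>
    have e: "nval i (entry (NConst 0)) t = \<Pi> ! r ! 0"
      using r m_pos by (subst nval_entry) (auto simp: r_def)
    have cand: "fst t v_cand = p"
      using 2 by (simp add: I_def p_def)
    have ne: "\<Pi> ! r \<noteq> []"
      using row_length[OF r] m_pos by auto
    note pos = position_eq_1_iff[OF ne, of p]
    note Suc_r = borda_take_Suc[of r \<Pi> m p] first_count_take_Suc[of r \<Pi> p]
    show ?case
      unfolding incr_def
      using 2 r e cand pos Suc_r k_eq
      by (intro wp_Seq wp_Cond wp_NAssign wp_SKIP wp_scan_ballot)
         (auto simp: I_def r_def[symmetric])
  next
    case (3 t)
    then have "fst t v_row = k" by (simp add: I_def)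
    with 3 show ?case
      by (intro Q) (auto simp: I_def p_def k_eq)
  qed
qed

text \<open>\<open>eval\<close> ties \<open>g\<close> to membership in \<open>S\<close> and
  \<open>e\<close> to \<open>f\<close>, but only in states with fresh scores and an unchanged
  \<open>v_bmax\<close>. \<open>upd\<close> is there because \<open>e\<close> is evaluated again
  after \<open>v_win\<close> has been overwritten.\<close>

lemma wp_argmax:
  fixes f :: "nat \<Rightarrow> real"
  assumes S: "S \<subseteq> candidates m"
    and eval: "\<And>t. fst t v_borda = borda m \<Pi> (fst t v_cand) \<Longrightarrow>
      fst t v_first = first_count \<Pi> (fst t v_cand) \<Longrightarrow> fst t v_cand \<in> candidates m \<Longrightarrow>
      fst t v_bmax = fst s v_bmax \<Longrightarrow>
      (bval i g t \<longleftrightarrow> fst t v_cand \<in> S) \<and> rval i e t = f (fst t v_cand)"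
    and upd: "\<And>t n. rval i e ((fst t)(v_win := n), snd t) = rval i e t"
    and Q: "\<And>t. (if S = {} then fst t v_win = 0 else selects f S (fst t v_win)) \<Longrightarrow>
      fst t v_bwin = fst s v_bwin \<Longrightarrow> Q t"
  shows "wp i (argmax g e) Q s"
proof -
  \<comment> \<open>Real variable 0 is constrained only once a candidate has been accepted; until
    then it may hold a leftover of an earlier scan.\<close>
  define best where "best T t \<longleftrightarrow>
    (if T = {} then fst t v_win = 0 else selects f T (fst t v_win) \<and> snd t 0 = f (fst t v_win))"
    for T and t :: store
  define I where "I t \<longleftrightarrow> 1 \<le> fst t v_cand \<and> fst t v_cand \<le> Suc m
    \<and> best (S \<inter> {..<fst t v_cand}) t
    \<and> fst t v_bwin = fst s v_bwin \<and> fst t v_bmax = fst s v_bmax" for t :: store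
  have S_pos: "0 \<notin> S"
    using S by (auto simp: candidates_def)
  have empty_iff: "T = {} \<longleftrightarrow> fst t v_win = 0" if "best T t" "T \<subseteq> S" for T t
    using that S_pos by (auto simp: best_def selects_def split: if_splits)
  show ?thesis
    unfolding argmax_def
  proof (intro wp_Seq wp_NAssign,
      rule wp_While[where I = I and \<mu> = "\<lambda>t. Suc m - fst t v_cand"], goal_cases)
    case 1
    have "S \<inter> {..<1} = {}" using S_pos by auto
    then show ?case by (simp add: I_def best_def)
  next
    case (2 t)
    define p T where "p = fst t v_cand" and "T = S \<inter> {..<p}"
    have p: "p \<in> candidates m" "p \<noteq> 0"
      using 2 by (auto simp: I_def p_def candidates_def)
    have T: "best T t"
      using 2 by (simp add: I_def T_def p_def)
    have T_empty: "T = {} \<longleftrightarrow> fst t v_win = 0"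
      using empty_iff[OF T] by (simp add: T_def)
    have T_Suc: "S \<inter> {..<Suc p} = (if p \<in> S then insert p T else T)"
      by (auto simp: T_def less_Suc_eq)
    have ins: "selects f (insert p T) (if f w < f p then p else w)" if "selects f T w" for w
      by (rule selects_insert_above[OF that]) (simp add: T_def)
    show ?case
    proof (rule wp_Seq, rule wp_compute_scores, goal_cases)
      case (1 u)
      have u: "fst u v_cand = p" "fst u v_win = fst t v_win" "snd u = snd t"
        "fst u v_bwin = fst s v_bwin" "fst u v_bmax = fst s v_bmax"
        using 1 2 by (auto simp: I_def p_def)
      have ev: "bval i g u \<longleftrightarrow> p \<in> S" "rval i e u = f p"
        using eval[of u] 1 u p by (auto simp: p_def)
      \<comment> \<open>\<open>better\<close> and \<open>same\<close> treat the two branches of the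
        conditional; \<open>inv\<close> adds the increment of \<open>v_cand\<close> and the decrease
        of the variant.\<close>
      let ?new = "fst t v_win = 0 \<or> snd t 0 < f p"
      have better: "best (S \<inter> {..<Suc p}) ((fst u)(v_win := p), (snd u)(0 := f p))"
        if "p \<in> S" ?new
        using that T T_empty ins[of "fst t v_win"]
        by (cases "T = {}") (simp_all add: best_def T_Suc selects_singleton)
      have same: "best (S \<inter> {..<Suc p}) u" if "\<not> (p \<in> S \<and> ?new)"
        using that T T_empty ins[of "fst t v_win"] u
        by (cases "T = {}"; cases "p \<in> S") (simp_all add: best_def T_Suc)
      have inv: "I ((fst v)(v_cand := Suc p), snd v) \<and> Suc m - Suc p < Suc m - p"
        if "best (S \<inter> {..<Suc p}) v" "fst v v_bwin = fst s v_bwin" "fst v v_bmax = fst s v_bmax"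
        for v :: store
        using that p by (auto simp: I_def best_def candidates_def)
      show ?case
        unfolding incr_def
      proof (intro wp_Seq wp_Cond wp_NAssign wp_RAssign wp_SKIP, goal_cases)
        case 1
        then have "p \<in> S" ?new using u ev by auto
        moreover have "rval i e ((fst u)(v_win := p), snd u) = f p"
          using upd[of u p] ev by simp
        ultimately show ?case
          using inv[OF better] u by (simp add: p_def)
      next
        case 2
        then have "\<not> (p \<in> S \<and> ?new)" using u ev by auto
        from inv[OF same[OF this]] show ?case
          using u by (simp add: p_def)
      qed
    qed
  next
    case (3 t)
    then have "fst t v_cand = Suc m" by (simp add: I_def)
    moreover have "S \<inter> {..<Suc m} = S"
      using S by (auto simp: candidates_def)
    ultimately show ?case
      using 3 by (intro Q) (auto simp: I_def best_def split: if_splits)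
  qed
qed

lemma bval_e_popular:
  "fst t v_first = first_count \<Pi> p \<Longrightarrow> bval i e_popular t \<longleftrightarrow> popular \<alpha> \<Pi> p"
  by (simp add: e_popular_def popular_iff k_eq not_less)

lemma bval_e_eligible:
  assumes "fst t v_borda = borda m \<Pi> p" and "fst t v_first = first_count \<Pi> p"
    and "fst t v_bmax = borda_max m \<Pi>" and "p \<in> candidates m"
  shows "bval i e_eligible t \<longleftrightarrow> p \<in> eligible \<alpha> \<beta> m \<Pi>"
  using assms by (simp add: e_eligible_def eligible_def bval_e_popular not_less)

text \<open>Program and definition share the same total division, so they agree even where a
  denominator vanishes.\<close>

lemma rval_e_hybrid:
  assumes "fst t v_borda = borda m \<Pi> p" and "fst t v_first = first_count \<Pi> p"
  shows "rval i e_hybrid t = hybrid lam m \<Pi> p"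
  using assms by (simp add: e_hybrid_def hybrid_def k_eq)

lemma wp_chb_program: "wp i chb_program (\<lambda>t. CHB \<alpha> \<beta> lam m \<Pi> (fst t v_win)) s"
  unfolding chb_program_def
proof (rule wp_Seq, rule wp_argmax[where S = "candidates m" and f = "\<lambda>p. real (borda m \<Pi> p)"],
    goal_cases)
  \<comment> \<open>Cases 1 to 3 are simple side conditions on the Borda scan; case 4 runs the rest
    of the program from the state that the scan leaves.\<close>
  case (4 t)
  define b where "b = fst t v_win"
  have b: "selects (borda m \<Pi>) (candidates m) b"
    using 4 m_pos by (auto simp: selects_real_iff b_def candidates_def split: if_splits)
  show ?case
  proof (rule wp_Seq, rule wp_NAssign, rule wp_Seq, rule wp_compute_scores, goal_cases)
    case (1 u)
    then have u: "fst u v_win = b" "fst u v_borda = borda_max m \<Pi>"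
      "fst u v_first = first_count \<Pi> b"
      by (simp_all add: b_def borda_max_eq[OF b])
    show ?case
    proof (intro wp_Seq wp_NAssign wp_Cond wp_SKIP, goal_cases)
      case 1
      then show ?case
        using u b by (simp add: bval_e_popular[of _ b] CHB.popular_borda_winner)
    next
      case 2
      then have np: "\<not> popular \<alpha> \<Pi> b"
        using u by (simp add: bval_e_popular[of _ b])
      show ?case
      proof (rule wp_argmax[where S = "eligible \<alpha> \<beta> m \<Pi>" and f = "hybrid lam m \<Pi>"], goal_cases)
        case 1
        show ?case by (auto simp: eligible_def)
      next
        case (2 v)
        then show ?case
          using u by (simp add: bval_e_eligible rval_e_hybrid)
      next
        case 3
        show ?case by (simp add: e_hybrid_def)
      next
        case (4 v)
        \<comment> \<open>Hence after the second scan \<open>v_win = 0\<close> holds exactly when no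
          candidate is eligible, which is the case of the rule \<open>fallback\<close>.\<close>
        have "0 \<notin> eligible \<alpha> \<beta> m \<Pi>"
          by (simp add: eligible_def candidates_def)
        with 4 u b np show ?case
          by (intro wp_Cond wp_NAssign wp_SKIP)
             (auto split: if_splits dest: selects_in intro: CHB.intros)
      qed
    qed
  qed
qed simp_all

end

section \<open>Computability, and existence and uniqueness of the outcome\<close>

lemma CHB_computable: "CHB_computable \<alpha> \<beta> lam"
  unfolding CHB_computable_def
\<comment> \<open>The program is fixed before \<open>m\<close>, \<open>k\<close> and
  \<open>\<Pi>\<close>; it reads these and the real parameters from its input.\<close>
proof (intro exI[of _ chb_program] allI impI)
  fix m k \<Pi>
  assume "m \<ge> 1" "profile m k \<Pi>"
  then interpret chb_instance \<alpha> \<beta> lam m k \<Pi> "chb_input \<alpha> \<beta> lam m k \<Pi>"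
    by unfold_locales simp_all
  from wp_chb_program[of "(\<lambda>_. 0, \<lambda>_. 0)"]
  show "\<exists>p. CHB \<alpha> \<beta> lam m \<Pi> p \<and> halts_with chb_program (chb_input \<alpha> \<beta> lam m k \<Pi>) p"
    by (auto simp: wp_def halts_with_def)
qed

theorem proposition4p4:
  fixes \<alpha> \<beta> lam :: real
  assumes "\<alpha> \<in> {0..1}" and "\<beta> \<in> {0..1}" and "lam \<in> {0..1}"
  shows "CHB_deterministic \<alpha> \<beta> lam
     \<and> CHB_computable \<alpha> \<beta> lam
     \<and> (\<forall>m k \<Pi>. m \<ge> 1 \<longrightarrow> profile m k \<Pi> \<longrightarrow>
          (\<exists>!p. p \<in> candidates m \<and> CHB \<alpha> \<beta> lam m \<Pi> p))"
proof (intro conjI allI impI)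
  show "CHB_deterministic \<alpha> \<beta> lam"
    by (auto simp: CHB_deterministic_def intro: CHB_unique)
  show "CHB_computable \<alpha> \<beta> lam"
    by (rule CHB_computable)
  fix m k \<Pi>
  assume "m \<ge> 1" "profile m k \<Pi>"
  \<comment> \<open>Existence of an outcome is read off from what the program returns.\<close>
  with CHB_computable obtain p where "CHB \<alpha> \<beta> lam m \<Pi> p"
    unfolding CHB_computable_def by metis
  then show "\<exists>!p. p \<in> candidates m \<and> CHB \<alpha> \<beta> lam m \<Pi> p"
    by (auto intro: CHB_in_candidates CHB_unique)
qed

end
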